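(* In the simplified unregulated XAI model with firms using different XAI methods described in the context, unregulated XAI can lead to symmetric XAI levels, and hence to vertical XAI fairness: there exist parameters $\beta,t,p,q>0$ for which the game has an equilibrium with $\xi_1^*=\xi_2^*$.
   Context: Simplified model. Two firms located at $e_1=0$, $e_2=1$ on $[0,1]$; customers $(x,\theta)$ uniform on $[0,1]^2$ with utility $u_i=\theta q_i-p_i-t(1-\xi_i)|x-e_i|$ (up to a constant) from firm $i$; profit of firm $i$ is price times demand minus $\beta q_i^2$. Stage 0: firms simultaneously choose XAI levels $\xi_1,\xi_2\in[0,1]$ freely. Stage 1: firms simultaneously choose qualities $q_1,q_2\in\{0,q\}$. Stage 2: firms simultaneously choose prices in $\{0,p\}$. Only equilibria in which both firms enter the market, i.e. choose price $p$ in stage 2, are considered. The market is explanation-dominated. With $\bar\xi=(1-\xi_1)+(1-\xi_2)>0$ and $\xi_r=(1-\xi_2)/\bar\xi$, the stage-1 payoffs $(\pi_1,\pi_2)$ (with both prices equal to $p$) are: $(q_1,q_2)=(0,0)$: $\big(\xi_rp,\ (1-\xi_r)p\big)$; $(q_1,q_2)=(q,0)$: $\big((\xi_r+\tfrac{q}{2t\bar\xi})p-\beta q^2,\ ((1-\xi_r)-\tfrac{q}{2t\bar\xi})p\big)$; $(q_1,q_2)=(0,q)$: $\big((\xi_r-\tfrac{q}{2t\bar\xi})p,\ ((1-\xi_r)+\tfrac{q}{2t\bar\xi})p-\beta q^2\big)$; $(q_1,q_2)=(q,q)$: $\big(\xi_rp-\beta q^2,\ (1-\xi_r)p-\beta q^2\big)$.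 An equilibrium consists of XAI levels $(\xi_1^*,\xi_2^* )$ with $\bar\xi>0$ and, for each pair of XAI levels with $\bar\xi>0$, a Nash equilibrium of the corresponding stage-1 game, such that no firm can increase its resulting payoff by unilaterally changing its XAI level (to another level with $\bar\xi>0$). Vertical XAI fairness means that all customers $(x,\theta)$, $\theta\in[0,1]$, with the same $x$ receive the same level of explanations, which holds when $\xi_1=\xi_2$. *)

theory Defs
  imports Complex_Main
begin

text \<open>
  Pure Nash equilibria of a two-player game whose strategy profiles are restricted to a set \<open>F\<close>:
  no player gains by a unilateral deviation that stays in \<open>F\<close>.  A set \<open>F\<close> that is not a
  product is needed for the choice of XAI levels below.
\<close>

definition nash_equilibrium ::
  "('a \<times> 'b) set \<Rightarrow> ('a \<times> 'b \<Rightarrow> real) \<Rightarrow> ('a \<times> 'b \<Rightarrow> real) \<Rightarrow> 'a \<times> 'b \<Rightarrow> bool" where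
  "nash_equilibrium F u1 u2 s \<longleftrightarrow>
     s \<in> F \<and>
     (\<forall>a. (a, snd s) \<in> F \<longrightarrow> u1 (a, snd s) \<le> u1 s) \<and>
     (\<forall>b. (fst s, b) \<in> F \<longrightarrow> u2 (fst s, b) \<le> u2 s)"

text \<open>
  In the following, \<open>\<xi> = (\<xi>\<^sub>1, \<xi>\<^sub>2)\<close> are the XAI levels and \<open>k = (q\<^sub>1, q\<^sub>2)\<close>
  the qualities of firm 1 (located at 0) and firm 2 (located at 1).
\<close>

definition xi_bar :: "real \<times> real \<Rightarrow> real" where
  "xi_bar \<xi> = (1 - fst \<xi>) + (1 - snd \<xi>)"

definition xi_rel :: "real \<times> real \<Rightarrow> real" where
  "xi_rel \<xi> = (1 - snd \<xi>) / xi_bar \<xi>"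

text \<open>
  Utility, up to a common constant, of customer \<open>(x, \<theta>)\<close> from a firm at location \<open>e\<close> with
  quality \<open>qi\<close>, price \<open>p\<close> and XAI level \<open>\<xi>i\<close>.
\<close>

definition utility :: "real \<Rightarrow> real \<Rightarrow> real \<Rightarrow> real \<Rightarrow> real \<Rightarrow> real \<Rightarrow> real \<Rightarrow> real" where
  "utility t e \<xi>i qi p x \<theta> = \<theta> * qi - p - t * (1 - \<xi>i) * \<bar>x - e\<bar>"

lemma utility_compare:
  assumes "t > 0" "xi_bar \<xi> > 0" "0 \<le> x" "x \<le> 1"
  shows "utility t 0 (fst \<xi>) q1 p x \<theta> \<ge> utility t 1 (snd \<xi>) q2 p x \<theta> \<longleftrightarrow>
         x \<le> xi_rel \<xi> + \<theta> * (q1 - q2) / (t * xi_bar \<xi>)"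
proof -
  have "xi_rel \<xi> + \<theta> * (q1 - q2) / (t * xi_bar \<xi>) =
        (t * (1 - snd \<xi>) + \<theta> * (q1 - q2)) / (t * xi_bar \<xi>)"
    using assms by (simp add: xi_rel_def field_simps)
  moreover have "t * xi_bar \<xi> > 0" using assms by simp
  ultimately have "x \<le> xi_rel \<xi> + \<theta> * (q1 - q2) / (t * xi_bar \<xi>) \<longleftrightarrow>
        x * (t * xi_bar \<xi>) \<le> t * (1 - snd \<xi>) + \<theta> * (q1 - q2)"
    by (simp add: pos_le_divide_eq)
  also have "\<dots> \<longleftrightarrow> utility t 0 (fst \<xi>) q1 p x \<theta> \<ge> utility t 1 (snd \<xi>) q2 p x \<theta>"
    using assms by (simp add: utility_def xi_bar_def abs_if algebra_simps)
  finally show ?thesis by simp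
qed

text \<open>
  The market is explanation-dominated: the demand of firm 1 is the mean over \<open>\<theta>\<close>, uniform on
  \<open>[0,1]\<close>, of the threshold in \<open>utility_compare\<close>.  The game uses this expression
  at all XAI levels, without truncation to \<open>[0,1]\<close>.
\<close>

definition demand1 :: "real \<Rightarrow> real \<times> real \<Rightarrow> real \<times> real \<Rightarrow> real" where
  "demand1 t \<xi> k = xi_rel \<xi> + (fst k - snd k) / (2 * t * xi_bar \<xi>)"

definition profit1 :: "real \<Rightarrow> real \<Rightarrow> real \<Rightarrow> real \<times> real \<Rightarrow> real \<times> real \<Rightarrow> real" where
  "profit1 \<beta> t p \<xi> k = demand1 t \<xi> k * p - \<beta> * (fst k)\<^sup>2"

definition profit2 :: "real \<Rightarrow> real \<Rightarrow> real \<Rightarrow> real \<times> real \<Rightarrow> real \<times> real \<Rightarrow> real" where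
  "profit2 \<beta> t p \<xi> k = (1 - demand1 t \<xi> k) * p - \<beta> * (snd k)\<^sup>2"

lemma profit_table:
  "profit1 \<beta> t p \<xi> (0, 0) = xi_rel \<xi> * p"
  "profit2 \<beta> t p \<xi> (0, 0) = (1 - xi_rel \<xi>) * p"
  "profit1 \<beta> t p \<xi> (q, 0) = (xi_rel \<xi> + q / (2 * t * xi_bar \<xi>)) * p - \<beta> * q\<^sup>2"
  "profit2 \<beta> t p \<xi> (q, 0) = ((1 - xi_rel \<xi>) - q / (2 * t * xi_bar \<xi>)) * p"
  "profit1 \<beta> t p \<xi> (0, q) = (xi_rel \<xi> - q / (2 * t * xi_bar \<xi>)) * p"
  "profit2 \<beta> t p \<xi> (0, q) = ((1 - xi_rel \<xi>) + q / (2 * t * xi_bar \<xi>)) * p - \<beta> * q\<^sup>2"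
  "profit1 \<beta> t p \<xi> (q, q) = xi_rel \<xi> * p - \<beta> * q\<^sup>2"
  "profit2 \<beta> t p \<xi> (q, q) = (1 - xi_rel \<xi>) * p - \<beta> * q\<^sup>2"
  by (simp_all add: profit1_def profit2_def demand1_def)

definition quality_equilibrium ::
  "real \<Rightarrow> real \<Rightarrow> real \<Rightarrow> real \<Rightarrow> real \<times> real \<Rightarrow> real \<times> real \<Rightarrow> bool" where
  "quality_equilibrium \<beta> t p q \<xi> k \<longleftrightarrow>
     nash_equilibrium ({0, q} \<times> {0, q}) (profit1 \<beta> t p \<xi>) (profit2 \<beta> t p \<xi>) k"

definition xai_levels :: "(real \<times> real) set" where
  "xai_levels = {\<xi> \<in> {0..1} \<times> {0..1}. xi_bar \<xi> > 0}"

text \<open>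
  An equilibrium consists of XAI levels \<open>\<xi>\<close> and a map \<open>\<sigma>\<close> that assigns to all feasible XAI levels,
  on and off the equilibrium path, the qualities played in the ensuing subgame.
\<close>

definition xai_equilibrium ::
  "real \<Rightarrow> real \<Rightarrow> real \<Rightarrow> real \<Rightarrow> real \<times> real \<Rightarrow> (real \<times> real \<Rightarrow> real \<times> real) \<Rightarrow> bool" where
  "xai_equilibrium \<beta> t p q \<xi> \<sigma> \<longleftrightarrow>
     (\<forall>\<zeta>\<in>xai_levels. quality_equilibrium \<beta> t p q \<zeta> (\<sigma> \<zeta>)) \<and>
     nash_equilibrium xai_levels
       (\<lambda>\<zeta>. profit1 \<beta> t p \<zeta> (\<sigma> \<zeta>)) (\<lambda>\<zeta>. profit2 \<beta> t p \<zeta> (\<sigma> \<zeta>)) \<xi>"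

text \<open>
  A customer receives the XAI level of a firm from which it buys, that is, of a utility-maximizing
  firm.  An indifferent customer may buy from either one, so that fairness does not depend on a
  tie-breaking rule.
\<close>

definition receives ::
  "real \<Rightarrow> real \<Rightarrow> real \<times> real \<Rightarrow> real \<times> real \<Rightarrow> real \<Rightarrow> real \<Rightarrow> real \<Rightarrow> bool" where
  "receives t p \<xi> k x \<theta> l \<longleftrightarrow>
     (let u1 = utility t 0 (fst \<xi>) (fst k) p x \<theta>;
          u2 = utility t 1 (snd \<xi>) (snd k) p x \<theta>
      in (u1 \<ge> u2 \<and> l = fst \<xi>) \<or> (u2 \<ge> u1 \<and> l = snd \<xi>))"

definition vertically_fair :: "real \<Rightarrow> real \<Rightarrow> real \<times> real \<Rightarrow> real \<times> real \<Rightarrow> bool" where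
  "vertically_fair t p \<xi> k \<longleftrightarrow>
     (\<forall>x\<in>{0..1}. \<forall>\<theta>\<in>{0..1}. \<forall>\<theta>'\<in>{0..1}. \<forall>l l'.
        receives t p \<xi> k x \<theta> l \<longrightarrow> receives t p \<xi> k x \<theta>' l' \<longrightarrow> l = l')"

end

(* With beta = t = q = 1 and p = 2, investing in quality raises a firm's revenue by 1 / xi_bar at a
   cost of 1, whatever the rival does: investing is dominant below xi_bar = 1, not investing above,
   and at xi_bar = 1 both firms are indifferent.  The levels (1/2, 1/2) sit on this threshold, where
   we select the profile (0, 0), giving each firm the payoff 1.  A firm that lowers its level loses
   market share; a firm that raises it triggers investment by both, which costs it 1, whereas even
   with the whole market its revenue is only 2. *)
theory Submission
  imports Defs
begin

text \<open>The tie \<open>xi_bar \<xi> = 1\<close> must go to (0, 0): under (1, 1), slightly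
  lowering a level would save the cost 1 at little loss of share.\<close>

definition threshold_qualities :: "real \<times> real \<Rightarrow> real \<times> real" where
  "threshold_qualities \<xi> = (if xi_bar \<xi> \<ge> 1 then (0, 0) else (1, 1))"

lemma quality_equilibrium_threshold:
  assumes "xi_bar \<xi> > 0"
  shows "quality_equilibrium 1 1 2 1 \<xi> (threshold_qualities \<xi>)"
  using assms
  by (auto simp: quality_equilibrium_def nash_equilibrium_def threshold_qualities_def
      profit1_def profit2_def demand1_def field_simps)

lemma profit1_deviation:
  assumes "0 \<le> a" "a \<le> 1"
  shows "profit1 1 1 2 (a, 1/2) (threshold_qualities (a, 1/2)) \<le> 1"
proof -
  define X where "X = 3/2 - a"
  have "xi_bar (a, 1/2) = X" "xi_rel (a, 1/2) = (1/2) / X"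
    by (simp_all add: xi_rel_def xi_bar_def X_def)
  then have "profit1 1 1 2 (a, 1/2) (threshold_qualities (a, 1/2)) =
      (if X \<ge> 1 then 1 / X else 1 / X - 1)"
    by (simp add: threshold_qualities_def profit1_def demand1_def)
  \<comment> \<open>The bound is tight: at \<open>a = 1\<close>, \<open>X = 1/2\<close> and
    \<open>1 / X - 1\<close> is exactly 1.\<close>
  moreover have "X \<ge> 1/2"
    using assms by (simp add: X_def)
  ultimately show ?thesis
    by (simp add: field_simps)
qed

lemma profit2_deviation:
  assumes "0 \<le> b" "b \<le> 1"
  shows "profit2 1 1 2 (1/2, b) (threshold_qualities (1/2, b)) \<le> 1"
proof -
  define X where "X = 3/2 - b"
  have "X \<ge> 1/2"
    using assms by (simp add: X_def)
  \<comment> \<open>Since \<open>1 - b = X - 1/2\<close>, firm 2's share at equal qualities is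
    \<open>(1/2) / X\<close>, mirroring firm 1.\<close>
  have "xi_bar (1/2, b) = X" "xi_rel (1/2, b) = (X - 1/2) / X"
    by (simp_all add: xi_rel_def xi_bar_def X_def)
  then have "profit2 1 1 2 (1/2, b) (threshold_qualities (1/2, b)) =
      (if X \<ge> 1 then 1 / X else 1 / X - 1)"
    using \<open>X \<ge> 1/2\<close>
    by (simp add: threshold_qualities_def profit2_def demand1_def diff_divide_distrib)
  then show ?thesis
    using \<open>X \<ge> 1/2\<close> by (simp add: field_simps)
qed

lemma xai_equilibrium_threshold:
  "xai_equilibrium 1 1 2 1 (1/2, 1/2) threshold_qualities"
proof -
  have "profit1 1 1 2 (1/2, 1/2) (threshold_qualities (1/2, 1/2)) = 1"
    "profit2 1 1 2 (1/2, 1/2) (threshold_qualities (1/2, 1/2)) = 1"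
    by (simp_all add: threshold_qualities_def profit1_def profit2_def demand1_def
        xi_rel_def xi_bar_def)
  moreover have "(1/2, 1/2) \<in> xai_levels"
    by (simp add: xai_levels_def xi_bar_def)
  ultimately show ?thesis
    using quality_equilibrium_threshold profit1_deviation profit2_deviation
    by (simp add: xai_equilibrium_def nash_equilibrium_def xai_levels_def)
qed

text \<open>Both disjuncts of \<open>receives\<close> force \<open>l = c\<close>, whichever firm is
  chosen.\<close>

lemma vertically_fair_symmetric: "vertically_fair t p (c, c) k"
  by (simp add: vertically_fair_def receives_def Let_def)

theorem proposition10:
  shows "\<exists>(\<beta>::real) (t::real) (p::real) (q::real).
    \<beta> > 0 \<and> t > 0 \<and> p > 0 \<and> q > 0 \<and>
    (\<exists>(\<xi>1::real) (\<xi>2::real) \<sigma>.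
       xai_equilibrium \<beta> t p q (\<xi>1, \<xi>2) \<sigma> \<and>
       \<xi>1 = \<xi>2 \<and>
       vertically_fair t p (\<xi>1, \<xi>2) (\<sigma> (\<xi>1, \<xi>2)))"
proof -
  have "(1::real) > 0" "(2::real) > 0" by simp_all
  then show ?thesis
    using xai_equilibrium_threshold vertically_fair_symmetric by blast
qed

end
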